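(* Let $p$ be an odd prime, let $G$ be a finite $p$-group and let $V$ be a faithful $\mathbb{F}_pG$-module such that $\Omega_1(Z(G))$ contains no element that is quadratic on $V$. (1) If $A$ is an abelian normal subgroup of $G$, then $A$ does not contain any offender of $G$ on $V$. (2) If $E$ is an offender of $G$ on $V$, then $[G',E]\neq 1$, where $G'$ is the derived subgroup of $G$.
   Context: Modules are finite-dimensional right modules, and $*$ denotes the module action. For $v\in V$, $g\in G$ put $[v,g]=v*(g-1)$. For a subspace $U$ of $V$, $[U,g]=\{[u,g] \mid u\in U\}$, and $[V,g,g]=[[V,g],g]$. A non-identity element $g\in G$ is quadratic on $V$ if $[V,g,g]=0$, i.e. $v*(g-1)^2=0$ for all $v\in V$. For $H\leq G$, $C_V(H)=\{v\in V \mid v*h=v \text{ for all } h\in H\}$ and $j_H(V)=\dfrac{|H|\,|C_V(H)|}{|V|}$. An offender of $G$ on $V$ is a non-trivial elementary abelian $p$-subgroup $E\leq G$ with $j_E(V)\geq 1$. $\Omega_1(Z(G))$ is the subgroup of the center generated by the elements of order dividing $p$. *)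

theory Defs
  imports
    "HOL-Algebra.Algebra"
    "HOL-Number_Theory.Residues"
    "Jordan_Normal_Form.Missing_VectorSpace"
begin

section \<open>Groups\<close>

definition finite_p_group :: "nat \<Rightarrow> ('g, 'a) monoid_scheme \<Rightarrow> bool" where
  "finite_p_group p G \<longleftrightarrow>
     group G \<and> finite (carrier G) \<and> (\<exists>n. order G = p ^ n)"

definition commutative_subgroup :: "('g, 'a) monoid_scheme \<Rightarrow> 'g set \<Rightarrow> bool" where
  "commutative_subgroup G H \<longleftrightarrow> subgroup H G \<and> comm_group (G\<lparr>carrier := H\<rparr>)"

definition elementary_abelian_subgroup :: "nat \<Rightarrow> ('g, 'a) monoid_scheme \<Rightarrow> 'g set \<Rightarrow> bool" where
  "elementary_abelian_subgroup p G E \<longleftrightarrow>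
     commutative_subgroup G E \<and> (\<forall>x\<in>E. x [^]\<^bsub>G\<^esub> p = \<one>\<^bsub>G\<^esub>)"

definition group_center :: "('g, 'a) monoid_scheme \<Rightarrow> 'g set" where
  "group_center G = {z \<in> carrier G. \<forall>x\<in>carrier G. x \<otimes>\<^bsub>G\<^esub> z = z \<otimes>\<^bsub>G\<^esub> x}"

text \<open>\<open>Omega1 p G H\<close> is \<open>\<Omega>\<^sub>1(H)\<close> for a subgroup \<open>H\<close> of \<open>G\<close>.
  The elements of order dividing \<open>p\<close> are those with \<open>x\<^sup>p = 1\<close>.\<close>

definition Omega1 :: "nat \<Rightarrow> ('g, 'a) monoid_scheme \<Rightarrow> 'g set \<Rightarrow> 'g set" where
  "Omega1 p G H = generate G {x \<in> H. x [^]\<^bsub>G\<^esub> p = \<one>\<^bsub>G\<^esub>}"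

text \<open>\<open>[H, K]\<close>, with the commutator convention of \<^const>\<open>derived\<close>.  For
  subgroups \<open>H\<close> and \<open>K\<close>, taking \<open>x\<^sup>-\<^sup>1y\<^sup>-\<^sup>1xy\<close> instead gives the same set of generators.\<close>

definition commutator_subgroup :: "('g, 'a) monoid_scheme \<Rightarrow> 'g set \<Rightarrow> 'g set \<Rightarrow> 'g set" where
  "commutator_subgroup G H K =
     generate G (\<Union>x\<in>H. \<Union>y\<in>K. {x \<otimes>\<^bsub>G\<^esub> y \<otimes>\<^bsub>G\<^esub> inv\<^bsub>G\<^esub> x \<otimes>\<^bsub>G\<^esub> inv\<^bsub>G\<^esub> y})"


section \<open>Modules over a group algebra\<close>

text \<open>A finite-dimensional right \<open>\<F>\<^sub>pG\<close>-module is given as a finite-dimensional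
  \<open>\<F>\<^sub>p\<close>-space \<open>V\<close> with a linear right action of \<open>G\<close>; \<open>act v g\<close> is \<open>v * g\<close>.
  The field \<open>\<F>\<^sub>p\<close> is \<^term>\<open>residue_ring (int p)\<close>.\<close>

locale FpG_module =
  group G + vectorspace "residue_ring (int p)" V
  for p :: nat
    and G :: "('g, 'a) monoid_scheme"
    and V :: "(int, 'v, 'b) module_scheme"
    and act :: "'v \<Rightarrow> 'g \<Rightarrow> 'v" +
  assumes finite_dimensional: "fin_dim"
    and act_linear: "g \<in> carrier G \<Longrightarrow> (\<lambda>v. act v g) \<in> module_hom (residue_ring (int p)) V V"
    and act_one: "v \<in> carrier V \<Longrightarrow> act v \<one>\<^bsub>G\<^esub> = v"
    and act_mult: "\<lbrakk>v \<in> carrier V; g \<in> carrier G; h \<in> carrier G\<rbrakk>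
      \<Longrightarrow> act v (g \<otimes>\<^bsub>G\<^esub> h) = act (act v g) h"

definition faithful_module ::
    "('g, 'a) monoid_scheme \<Rightarrow> (int, 'v, 'b) module_scheme \<Rightarrow> ('v \<Rightarrow> 'g \<Rightarrow> 'v) \<Rightarrow> bool" where
  "faithful_module G V act \<longleftrightarrow>
     (\<forall>g\<in>carrier G. (\<forall>v\<in>carrier V. act v g = v) \<longrightarrow> g = \<one>\<^bsub>G\<^esub>)"

text \<open>\<open>[U, g] = {u * (g - 1) | u \<in> U}\<close>, where \<open>u * (g - 1) = u * g - u\<close>.\<close>

definition act_commutator ::
    "(int, 'v, 'b) module_scheme \<Rightarrow> ('v \<Rightarrow> 'g \<Rightarrow> 'v) \<Rightarrow> 'v set \<Rightarrow> 'g \<Rightarrow> 'v set" where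
  "act_commutator V act U g = {act u g \<ominus>\<^bsub>V\<^esub> u | u. u \<in> U}"

definition quadratic_on ::
    "('g, 'a) monoid_scheme \<Rightarrow> (int, 'v, 'b) module_scheme \<Rightarrow> ('v \<Rightarrow> 'g \<Rightarrow> 'v) \<Rightarrow> 'g \<Rightarrow> bool" where
  "quadratic_on G V act g \<longleftrightarrow>
     g \<in> carrier G \<and> g \<noteq> \<one>\<^bsub>G\<^esub> \<and>
     act_commutator V act (act_commutator V act (carrier V) g) g = {\<zero>\<^bsub>V\<^esub>}"

definition fixed_space ::
    "(int, 'v, 'b) module_scheme \<Rightarrow> ('v \<Rightarrow> 'g \<Rightarrow> 'v) \<Rightarrow> 'g set \<Rightarrow> 'v set" where
  "fixed_space V act H = {v \<in> carrier V. \<forall>h\<in>H. act v h = v}"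

definition j_ratio ::
    "(int, 'v, 'b) module_scheme \<Rightarrow> ('v \<Rightarrow> 'g \<Rightarrow> 'v) \<Rightarrow> 'g set \<Rightarrow> real" where
  "j_ratio V act H =
     real (card H) * real (card (fixed_space V act H)) / real (card (carrier V))"

definition offender ::
    "nat \<Rightarrow> ('g, 'a) monoid_scheme \<Rightarrow> (int, 'v, 'b) module_scheme \<Rightarrow> ('v \<Rightarrow> 'g \<Rightarrow> 'v)
      \<Rightarrow> 'g set \<Rightarrow> bool" where
  "offender p G V act E \<longleftrightarrow>
     elementary_abelian_subgroup p G E \<and> E \<noteq> {\<one>\<^bsub>G\<^esub>} \<and> j_ratio V act E \<ge> 1"

end

theory Submission
  imports Defs
begin

text \<open>Write \<open>w(H) = |H| |C\<^sub>V(H)|\<close>, so that \<open>E\<close> is an offender iff \<open>w(E) \<ge> |V|\<close>.  Let \<open>A\<close> be an abelian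
  normal subgroup containing an offender, and let \<open>F \<le> A\<close> be nontrivial with \<open>w(F)\<close> maximal and, subject
  to that, \<open>F\<close> minimal.  A Thompson-style replacement argument gives \<open>[V, F, F] = 0\<close>.  If \<open>K\<close> is a
  conjugate of \<open>F\<close>, then
  \<open>w(F) w(K) \<le> w(F K) |F \<inter> K| |C\<^sub>V(F) + C\<^sub>V(K)|\<close> forces \<open>F = K\<close> or \<open>V = C\<^sub>V(F) + C\<^sub>V(K)\<close>,
  and \<open>[V, F, K] = 0\<close> in both cases.  So \<open>F\<close> lies in the normal subgroup of all elements acting
  trivially on \<open>W = C\<^sub>V(\<langle>F\<^sup>G\<rangle>)\<close> and on \<open>V / W\<close>.  All its nontrivial elements are quadratic, and it
  contains a central element of order \<open>p\<close>.  For the second part, \<open>[G', E] = 1\<close> makes the normal closure of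
  \<open>E\<close> abelian.\<close>

section \<open>Counting and Fermat's little theorem\<close>

text \<open>\<open>A\<close> is the disjoint union of the fibres of \<open>f\<close>, each with at
  most \<open>k\<close> elements. This supplies the lower bounds for the sizes of \<open>H K\<close>
  and of \<open>d F + C_V(F)\<close> below.\<close>

lemma card_le_card_image_mult:
  assumes "finite A" and "\<And>y. y \<in> A \<Longrightarrow> card {x \<in> A. f x = f y} \<le> k"
  shows "card A \<le> card (f ` A) * k"
proof -
  have "card A = (\<Sum>x\<in>A. 1)"
    by simp
  also have "\<dots> = (\<Sum>z\<in>f ` A. \<Sum>x | x \<in> A \<and> f x = z. 1)"
    using assms(1) by (rule sum.image_gen)
  also have "\<dots> = (\<Sum>z\<in>f ` A. card {x \<in> A. f x = z})"
    by simp
  also have "\<dots> \<le> (\<Sum>z\<in>f ` A. k)"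
    using assms(2) by (intro sum_mono) auto
  finally show ?thesis by simp
qed

text \<open>Fermat's \<open>b^p = b (mod p)\<close>, which in this form also covers multiples of
  \<open>p\<close>, is iterated \<open>n\<close> times. It is applied with \<open>a = 2\<close> and
  \<open>p ^ n\<close> the order of \<open>G\<close>.\<close>

lemma cong_power_prime_power:
  fixes a p :: nat
  assumes "Factorial_Ring.prime p"
  shows "[a ^ (p ^ n) = a] (mod p)"
proof (induction n)
  case 0
  show ?case by simp
next
  case (Suc n)
  have fermat: "[b ^ p = b] (mod p)" for b :: nat
  proof (cases "p dvd b")
    case True
    then have "p dvd b ^ p"
      using dvd_power[of p b] prime_gt_0_nat[OF assms] by (metis dvd_power dvd_trans)
    with True show ?thesis
      by (simp add: cong_def mod_eq_0_iff_dvd)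
  next
    case False
    have "[b * b ^ (p - 1) = b * 1] (mod p)"
      using fermat_theorem[OF assms False] by (rule cong_scalar_left)
    then show ?thesis
      using prime_gt_0_nat[OF assms] by (simp add: power_eq_if)
  qed
  have "[(a ^ p ^ n) ^ p = a ^ p ^ n] (mod p)"
    by (rule fermat)
  with Suc show ?case
    by (metis cong_trans power_Suc2 power_mult)
qed

lemma (in abelian_group) add_diff_cancel:
  assumes "x \<in> carrier G" "y \<in> carrier G" "z \<in> carrier G"
  shows "(x \<oplus> z) \<ominus> (y \<oplus> z) = x \<ominus> y"
proof -
  have "(x \<oplus> z) \<ominus> (y \<oplus> z) = x \<oplus> (z \<oplus> \<ominus> z) \<oplus> \<ominus> y"
    using assms by (simp add: minus_eq minus_add a_ac del: r_neg)
  then show ?thesis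
    using assms by (simp add: minus_eq r_neg)
qed

section \<open>Subgroups of finite \<open>p\<close>-groups\<close>

context group
begin

section \<open>Products of two subgroups\<close>

text \<open>If \<open>h k = h' k'\<close>, then \<open>h'^-1 h = k' k^-1\<close> lies in both
  \<open>H\<close> and \<open>K\<close>, so each fibre of the multiplication map embeds in
  \<open>H \<inter> K\<close>. The same count serves for sums of fixed spaces in the additive group
  of \<open>V\<close>.\<close>

lemma card_mult_le_card_set_mult:
  assumes H: "subgroup H G" and K: "subgroup K G" and fin: "finite H" "finite K"
  shows "card H * card K \<le> card (H <#> K) * card (H \<inter> K)"
proof -
  let ?f = "\<lambda>u. fst u \<otimes> snd u"
  have "card {u \<in> H \<times> K. ?f u = ?f w} \<le> card (H \<inter> K)" if w: "w \<in> H \<times> K" for w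
  proof (rule card_inj_on_le[where f = "\<lambda>u. inv (fst w) \<otimes> fst u"])
    have in_G: "fst u \<in> carrier G" "snd u \<in> carrier G" if "u \<in> H \<times> K" for u
      using that H K subgroup.mem_carrier by fastforce+
    show "inj_on (\<lambda>u. inv (fst w) \<otimes> fst u) {u \<in> H \<times> K. ?f u = ?f w}"
    proof (rule inj_onI)
      fix u v
      assume "u \<in> {u \<in> H \<times> K. ?f u = ?f w}" "v \<in> {u \<in> H \<times> K. ?f u = ?f w}"
        and "inv (fst w) \<otimes> fst u = inv (fst w) \<otimes> fst v"
      then have uv: "u \<in> H \<times> K" "v \<in> H \<times> K" "fst u = fst v" "?f u = ?f v"
        using in_G[of u] in_G[of v] in_G[OF w] by simp_all
      then have "snd u = snd v"
        using in_G[of u] in_G[of v] l_cancel[of "fst v" "snd u" "snd v"] by simp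
      with uv(3) show "u = v"
        by (simp add: prod_eq_iff)
    qed
    have "inv (fst w) \<otimes> fst u \<in> H \<inter> K" if u: "u \<in> H \<times> K" "?f u = ?f w" for u
    proof -
      have "inv (fst w) \<otimes> fst u = inv (fst w) \<otimes> (?f u \<otimes> inv (snd u))"
        using in_G[OF u(1)] by (simp add: m_assoc)
      also have "\<dots> = snd w \<otimes> inv (snd u)"
        unfolding u(2) using in_G[OF u(1)] in_G[OF w]
        by (simp add: m_assoc inv_solve_left')
      finally have "inv (fst w) \<otimes> fst u = snd w \<otimes> inv (snd u)" .
      moreover have "inv (fst w) \<otimes> fst u \<in> H"
        using u(1) w by (intro subgroup.m_closed[OF H] subgroup.m_inv_closed[OF H]) auto
      moreover have "snd w \<otimes> inv (snd u) \<in> K"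
        using u(1) w by (intro subgroup.m_closed[OF K] subgroup.m_inv_closed[OF K]) auto
      ultimately show ?thesis
        by simp
    qed
    then show "(\<lambda>u. inv (fst w) \<otimes> fst u) ` {u \<in> H \<times> K. ?f u = ?f w} \<subseteq> H \<inter> K"
      by blast
    show "finite (H \<inter> K)"
      using fin by blast
  qed
  then have "card (H \<times> K) \<le> card (?f ` (H \<times> K)) * card (H \<inter> K)"
    using fin by (intro card_le_card_image_mult) auto
  moreover have "?f ` (H \<times> K) = H <#> K"
    unfolding set_mult_def by force
  ultimately show ?thesis
    by (simp add: card_cartesian_product)
qed

text \<open>In the commutative group on \<open>A\<close> a product of two subgroups is a subgroup,
  and set products formed there and in \<open>G\<close> agree.\<close>

lemma subgroup_set_mult_of_commutative:
  assumes A: "commutative_subgroup G A"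
    and H: "subgroup H G" "H \<subseteq> A" and K: "subgroup K G" "K \<subseteq> A"
  shows "subgroup (H <#> K) G" and "H <#> K \<subseteq> A"
proof -
  have A': "subgroup A G" "comm_group (G\<lparr>carrier := A\<rparr>)"
    using A by (auto simp: commutative_subgroup_def)
  have "subgroup H (G\<lparr>carrier := A\<rparr>)" "subgroup K (G\<lparr>carrier := A\<rparr>)"
    using subgroup_incl A' H K by blast+
  then have "subgroup (H <#>\<^bsub>G\<lparr>carrier := A\<rparr>\<^esub> K) (G\<lparr>carrier := A\<rparr>)"
    using comm_group.mult_subgroups[OF A'(2)] by blast
  then have *: "subgroup (H <#> K) (G\<lparr>carrier := A\<rparr>)"
    by (simp add: set_mult_def)
  show "subgroup (H <#> K) G"
    using incl_subgroup[OF A'(1) *] .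
  show "H <#> K \<subseteq> A"
    using subgroup.subset[OF *] by simp
qed

lemma commutative_subgroup_commute:
  assumes "commutative_subgroup G A" "x \<in> A" "y \<in> A"
  shows "x \<otimes> y = y \<otimes> x"
  using assms comm_monoid.m_comm[of "G\<lparr>carrier := A\<rparr>" x y]
  by (auto simp: commutative_subgroup_def comm_group_def)

section \<open>Central elements in normal subgroups of a \<open>p\<close>-group\<close>

lemma conj_eq_self_iff:
  assumes "g \<in> carrier G" "x \<in> carrier G"
  shows "g \<otimes> x \<otimes> inv g = x \<longleftrightarrow> g \<otimes> x = x \<otimes> g"
  using assms by (metis inv_solve_right m_closed)

text \<open>The class equation on \<open>N\<close>: if no non-identity element of \<open>N\<close>
  were central, all conjugacy classes in \<open>N - {1}\<close> would have size divisible by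
  \<open>p\<close>. Then \<open>p\<close> would divide both \<open>|N| - 1\<close> and
  \<open>|N|\<close>.\<close>

lemma normal_meets_center:
  assumes fin: "finite (carrier G)" and order: "order G = p ^ n" and p: "Factorial_Ring.prime p"
    and N: "N \<lhd> G" "N \<noteq> {\<one>}"
  shows "\<exists>z \<in> N \<inter> group_center G. z \<noteq> \<one>"
proof (rule ccontr)
  assume none: "\<not> ?thesis"
  have sub: "subgroup N G"
    using N(1) by (rule normal_imp_subgroup)
  define \<phi> where "\<phi> = (\<lambda>g. \<lambda>h \<in> carrier G. g \<otimes> h \<otimes> inv g)"
  interpret conj: group_action G "carrier G" \<phi>
    unfolding \<phi>_def by (rule action_by_conjugation)
  have orb: "orbit G \<phi> x = {g \<otimes> x \<otimes> inv g | g. g \<in> carrier G}" if "x \<in> carrier G" for x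
    using that by (auto simp: orbit_def \<phi>_def)
  have p_dvd: "p dvd m" if "m dvd p ^ k" "m \<noteq> 1" for m k
    using that divides_primepow_nat[OF p] by (metis dvd_power gr0I power_0)
  have orbN: "orbit G \<phi> x \<subseteq> N" if "x \<in> N" for x
    using that orb[of x] normal.inv_op_closed2[OF N(1)] subgroup.mem_carrier[OF sub] by auto
  have card_orb: "p dvd card (orbit G \<phi> x)" if x: "x \<in> N" "x \<noteq> \<one>" for x
  proof (rule p_dvd)
    have xG: "x \<in> carrier G"
      using x sub subgroup.mem_carrier by fast
    show "card (orbit G \<phi> x) dvd p ^ n"
      using conj.orbit_stabilizer_theorem[OF xG] order by (metis dvd_triv_left)
    show "card (orbit G \<phi> x) \<noteq> 1"
    proof
      assume "card (orbit G \<phi> x) = 1"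
      then obtain y where y: "orbit G \<phi> x = {y}"
        using card_1_singletonE by blast
      have "x \<in> orbit G \<phi> x"
        using xG by (rule conj.orbit_refl)
      with y have "orbit G \<phi> x = {x}"
        by simp
      then have "\<forall>g\<in>carrier G. g \<otimes> x \<otimes> inv g = x"
        using orb[OF xG] by blast
      then have "x \<in> group_center G"
        using xG by (simp add: group_center_def conj_eq_self_iff)
      then show False
        using none x by blast
    qed
  qed
  \<comment> \<open>The indicator of \<open>N - {1}\<close>. The orbit formula sums over all of
    \<open>carrier G\<close>, and this function restricts it to the elements to be counted.\<close>
  define f where "f x = (if x \<in> N \<and> x \<noteq> \<one> then 1 else 0 :: nat)" for x
  have one_in: "\<one> \<in> N"
    using sub by (rule subgroup.one_closed)
  have finN: "finite N"
    using subgroup.subset[OF sub] fin by (rule finite_subset)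
  have "(\<Sum>x\<in>carrier G. f x) = (\<Sum>x\<in>N - {\<one>}. 1)"
    using fin subgroup.subset[OF sub] by (intro sum.mono_neutral_cong_right) (auto simp: f_def)
  then have sum_f: "(\<Sum>x\<in>carrier G. f x) = card N - 1"
    using one_in finN by simp
  have "p dvd (\<Sum>orb\<in>orbits G (carrier G) \<phi>. \<Sum>x\<in>orb. f x)"
  proof (rule dvd_sum)
    fix orb assume "orb \<in> orbits G (carrier G) \<phi>"
    then obtain x where x: "x \<in> carrier G" and orb_x: "orb = orbit G \<phi> x"
      by (auto simp: orbits_def)
    \<comment> \<open>An orbit that meets \<open>N - {1}\<close> stays in \<open>N\<close> by
      normality and misses the identity, which is conjugate only to itself; it contributes its size.
      Any other orbit contributes 0.\<close>
    show "p dvd (\<Sum>x\<in>orb. f x)"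
    proof (cases "\<exists>y\<in>orb. y \<in> N \<and> y \<noteq> \<one>")
      case True
      then obtain y where y: "y \<in> orb" "y \<in> N" "y \<noteq> \<one>"
        by blast
      have yG: "y \<in> carrier G"
        using y sub subgroup.mem_carrier by fast
      have "orbit G \<phi> y \<in> orbits G (carrier G) \<phi>" "orb \<in> orbits G (carrier G) \<phi>"
        using x yG orb_x by (auto simp: orbits_def)
      moreover have "y \<in> orbit G \<phi> y"
        using yG by (rule conj.orbit_refl)
      ultimately have orb_y: "orb = orbit G \<phi> y"
        using y(1) conj.disjoint_union by blast
      have "\<one> \<notin> orb"
      proof
        assume "\<one> \<in> orb"
        then obtain g where g: "g \<in> carrier G" "\<one> = g \<otimes> y \<otimes> inv g"
          using orb_y orb[OF yG] by blast
        then have "g \<otimes> y = g \<otimes> \<one>"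
          using yG by (metis inv_solve_right l_one m_closed one_closed r_one)
        then show False
          using l_cancel[of g y \<one>] g(1) yG y(3) by blast
      qed
      then have "(\<Sum>x\<in>orb. f x) = card orb"
        using orbN[OF y(2)] orb_y by (subst card_eq_sum, intro sum.cong) (auto simp: f_def)
      then show ?thesis
        using card_orb y orb_y by simp
    next
      case False
      then have "(\<Sum>x\<in>orb. f x) = 0"
        by (intro sum.neutral) (auto simp: f_def)
      then show ?thesis
        by simp
    qed
  qed
  then have "p dvd card N - 1"
    using conj.disjoint_sum[OF fin, of f] sum_f by simp
  moreover have "p dvd card N"
  proof (rule p_dvd)
    show "card N dvd p ^ n"
      using lagrange[OF sub] order by (metis dvd_triv_right)
    show "card N \<noteq> 1"
      using one_in N(2) by (metis card_1_singletonE singletonD)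
  qed
  moreover have "card N > 0"
    using one_in finN card_gt_0_iff by blast
  ultimately have "p dvd 1"
    by (metis One_nat_def Suc_leI dvd_diffD1)
  then show False
    using p by simp
qed

lemma pow_mem_subgroup:
  "subgroup H G \<Longrightarrow> x \<in> H \<Longrightarrow> x [^] (k :: nat) \<in> H"
  by (induction k) (auto simp: subgroup.one_closed subgroup.m_closed)

lemma pow_mem_center:
  assumes "x \<in> group_center G"
  shows "x [^] (k :: nat) \<in> group_center G"
proof (induction k)
  case 0
  then show ?case by (simp add: group_center_def)
next
  case (Suc k)
  have "y \<otimes> (x [^] k \<otimes> x) = x [^] k \<otimes> x \<otimes> y" if y: "y \<in> carrier G" for y
  proof -
    have xG: "x \<in> carrier G" and "x [^] k \<otimes> y = y \<otimes> x [^] k" "x \<otimes> y = y \<otimes> x"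
      using Suc assms y by (auto simp: group_center_def)
    then show ?thesis
      using y by (metis m_assoc nat_pow_closed)
  qed
  then show ?case
    using assms by (auto simp: group_center_def)
qed

text \<open>Take a non-identity central \<open>z\<close> in \<open>N\<close>. The last non-identity
  term of \<open>z\<close>, \<open>z^p\<close>, \<open>z^(p^2)\<close>, ... has order
  \<open>p\<close> and is still central and in \<open>N\<close>.\<close>

lemma normal_meets_Omega1_center:
  assumes fin: "finite (carrier G)" and order: "order G = p ^ n" and p: "Factorial_Ring.prime p"
    and N: "N \<lhd> G" "N \<noteq> {\<one>}"
  shows "\<exists>z \<in> N \<inter> Omega1 p G (group_center G). z \<noteq> \<one>"
proof -
  obtain z where z: "z \<in> N" "z \<in> group_center G" "z \<noteq> \<one>"
    using normal_meets_center[OF assms] by blast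
  have zG: "z \<in> carrier G"
    using z by (simp add: group_center_def)
  \<comment> \<open>\<open>p ^ k\<close> is the order of \<open>z\<close>. Some exponent works
    because \<open>z\<close> raised to the order of \<open>G\<close> is the identity.\<close>
  define k where "k = (LEAST k. z [^] (p ^ k) = \<one>)"
  have k: "z [^] (p ^ k) = \<one>"
    unfolding k_def by (rule LeastI[of _ n]) (use pow_order_eq_1[OF zG] order in metis)
  have "k \<noteq> 0"
    using k z zG by (metis nat_pow_eone power_0)
  then obtain l where l: "k = Suc l"
    using not0_implies_Suc by blast
  define y where "y = z [^] (p ^ l)"
  have "y \<noteq> \<one>"
    unfolding y_def using not_less_Least[of l "\<lambda>k. z [^] (p ^ k) = \<one>"] l k_def by simp
  moreover have "y \<in> N"
    unfolding y_def using z normal_imp_subgroup[OF N(1)] pow_mem_subgroup by blast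
  moreover have "y [^] p = \<one>"
    unfolding y_def using k l zG by (simp add: nat_pow_pow mult.commute)
  moreover have "y \<in> group_center G"
    unfolding y_def using z by (blast intro: pow_mem_center)
  ultimately show ?thesis
    unfolding Omega1_def by (blast intro: generate.incl)
qed

section \<open>Abelian normal closures\<close>

text \<open>Centralizers are subgroups, and this is used twice. \<open>S\<close> centralizes itself,
  so \<open>generate G S\<close> centralizes \<open>S\<close>; hence \<open>S\<close> centralizes
  \<open>generate G S\<close>, and therefore so does \<open>generate G S\<close>.\<close>

lemma commutative_subgroup_generate:
  assumes S: "S \<subseteq> carrier G" and comm: "\<And>x y. x \<in> S \<Longrightarrow> y \<in> S \<Longrightarrow> x \<otimes> y = y \<otimes> x"
  shows "commutative_subgroup G (generate G S)"
proof -
  have centralizer: "subgroup {x \<in> carrier G. \<forall>y\<in>T. x \<otimes> y = y \<otimes> x} G"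
    if T: "T \<subseteq> carrier G" for T
  proof (rule subgroupI)
    fix a assume a: "a \<in> {x \<in> carrier G. \<forall>y\<in>T. x \<otimes> y = y \<otimes> x}"
    have "inv a \<otimes> y = y \<otimes> inv a" if "y \<in> T" for y
    proof -
      have aG: "a \<in> carrier G" and yG: "y \<in> carrier G" and ay: "a \<otimes> y = y \<otimes> a"
        using a that T by auto
      have "inv a \<otimes> y = inv a \<otimes> (y \<otimes> a) \<otimes> inv a"
        using aG yG by (simp add: m_assoc)
      also have "\<dots> = y \<otimes> inv a"
        using aG yG by (simp flip: ay m_assoc)
      finally show ?thesis .
    qed
    then show "inv a \<in> {x \<in> carrier G. \<forall>y\<in>T. x \<otimes> y = y \<otimes> x}"
      using a by auto
  next
    fix a b assume ab: "a \<in> {x \<in> carrier G. \<forall>y\<in>T. x \<otimes> y = y \<otimes> x}"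
      "b \<in> {x \<in> carrier G. \<forall>y\<in>T. x \<otimes> y = y \<otimes> x}"
    have "a \<otimes> b \<otimes> y = y \<otimes> (a \<otimes> b)" if "y \<in> T" for y
    proof -
      have "y \<in> carrier G" "a \<in> carrier G" "b \<in> carrier G" "a \<otimes> y = y \<otimes> a" "b \<otimes> y = y \<otimes> b"
        using ab that T by auto
      then show ?thesis
        by (metis m_assoc)
    qed
    then show "a \<otimes> b \<in> {x \<in> carrier G. \<forall>y\<in>T. x \<otimes> y = y \<otimes> x}"
      using ab by auto
  next
    have "\<one> \<in> {x \<in> carrier G. \<forall>y\<in>T. x \<otimes> y = y \<otimes> x}"
      using T by auto
    then show "{x \<in> carrier G. \<forall>y\<in>T. x \<otimes> y = y \<otimes> x} \<noteq> {}"
      by blast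
  qed auto
  have sub: "subgroup (generate G S) G"
    using S by (rule generate_is_subgroup)
  have 1: "generate G S \<subseteq> {x \<in> carrier G. \<forall>y\<in>S. x \<otimes> y = y \<otimes> x}"
    using S comm by (intro generate_subgroup_incl centralizer) auto
  have 2: "generate G S \<subseteq> {x \<in> carrier G. \<forall>y\<in>generate G S. x \<otimes> y = y \<otimes> x}"
  proof (rule generate_subgroup_incl[OF _ centralizer[OF subgroup.subset[OF sub]]])
    show "S \<subseteq> {x \<in> carrier G. \<forall>y\<in>generate G S. x \<otimes> y = y \<otimes> x}"
    proof
      fix x assume x: "x \<in> S"
      have "x \<otimes> y = y \<otimes> x" if "y \<in> generate G S" for y
        using subsetD[OF 1 that] x by simp
      then show "x \<in> {x \<in> carrier G. \<forall>y\<in>generate G S. x \<otimes> y = y \<otimes> x}"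
        using x S by blast
    qed
  qed
  have "comm_group (G\<lparr>carrier := generate G S\<rparr>)"
    using 2 by (intro group.group_comm_groupI[OF subgroup_imp_group[OF sub]]) auto
  with sub show ?thesis
    by (simp add: commutative_subgroup_def)
qed

lemma conj_conj:
  assumes "g \<in> carrier G" "h \<in> carrier G" "x \<in> carrier G"
  shows "h \<otimes> (g \<otimes> x \<otimes> inv g) \<otimes> inv h = (h \<otimes> g) \<otimes> x \<otimes> inv (h \<otimes> g)"
  using assms by (simp add: inv_mult_group m_assoc)

text \<open>If \<open>[G', E] = 1\<close>, then \<open>E\<close> commutes with its conjugates, because \<open>g f g\<^sup>-\<^sup>1 \<in> G' f\<close>.\<close>

lemma abelian_normal_closure:
  assumes E: "commutative_subgroup G E"
    and triv: "commutator_subgroup G (derived G (carrier G)) E = {\<one>}"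
  obtains A where "A \<lhd> G" "commutative_subgroup G A" "E \<subseteq> A"
proof -
  have EG: "x \<in> carrier G" if "x \<in> E" for x
    using E that by (auto simp: commutative_subgroup_def dest: subgroup.mem_carrier)
  have D: "d \<in> carrier G" if "d \<in> derived G (carrier G)" for d
    using that derived_in_carrier by blast
  have commD: "d \<otimes> e = e \<otimes> d" if d: "d \<in> derived G (carrier G)" and e: "e \<in> E" for d e
  proof -
    have "d \<otimes> e \<otimes> inv d \<otimes> inv e \<in> commutator_subgroup G (derived G (carrier G)) E"
      unfolding commutator_subgroup_def using d e by (intro generate.incl) auto
    then have "d \<otimes> e \<otimes> inv d \<otimes> inv e = \<one>"
      using triv by simp
    then have "d \<otimes> e \<otimes> inv d = e"
      using D[OF d] EG[OF e] by (metis inv_closed inv_equality inv_inv m_closed)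
    then show ?thesis
      using D[OF d] EG[OF e] conj_eq_self_iff by blast
  qed
  have comm_conj: "g \<otimes> f \<otimes> inv g \<otimes> e = e \<otimes> (g \<otimes> f \<otimes> inv g)"
    if e: "e \<in> E" and f: "f \<in> E" and g: "g \<in> carrier G" for e f g
  proof -
    \<comment> \<open>The conjugate of \<open>f\<close> equals \<open>d \<otimes> f\<close>. Here
      \<open>e\<close> commutes with \<open>d\<close> by the hypothesis on commutators and with
      \<open>f\<close> because \<open>E\<close> is commutative.\<close>
    define d where "d = g \<otimes> f \<otimes> inv g \<otimes> inv f"
    have d: "d \<in> derived G (carrier G)"
      unfolding d_def derived_def using g EG[OF f] by (intro generate.incl) auto
    have eq: "g \<otimes> f \<otimes> inv g = d \<otimes> f"
      using g EG[OF f] by (simp add: d_def m_assoc)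
    have "f \<otimes> e = e \<otimes> f"
      using commutative_subgroup_commute[OF E f e] .
    then show ?thesis
      unfolding eq using commD[OF d e] D[OF d] EG[OF e] EG[OF f] by (metis m_assoc)
  qed
  define S where "S = {g \<otimes> f \<otimes> inv g | g f. g \<in> carrier G \<and> f \<in> E}"
  have SG: "S \<subseteq> carrier G"
    using EG by (auto simp: S_def)
  have conjS: "h \<otimes> s \<otimes> inv h \<in> S" if s: "s \<in> S" and h: "h \<in> carrier G" for s h
  proof -
    obtain g f where gf: "s = g \<otimes> f \<otimes> inv g" "g \<in> carrier G" "f \<in> E"
      using s by (auto simp: S_def)
    then show ?thesis
      using h EG conj_conj[of g h f] unfolding S_def by blast
  qed
  have "x \<otimes> y = y \<otimes> x" if x: "x \<in> S" and y: "y \<in> S" for x y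
  proof -
    obtain g f where gf: "y = g \<otimes> f \<otimes> inv g" "g \<in> carrier G" "f \<in> E"
      using y by (auto simp: S_def)
    note fG = EG[OF gf(3)]
    have xG: "x \<in> carrier G"
      using x SG by blast
    \<comment> \<open>Conjugating back by \<open>g\<close> turns \<open>y\<close> into
      \<open>f\<close>, an element of \<open>E\<close>. This reduces two arbitrary conjugates to the
      case just treated.\<close>
    define z where "z = inv g \<otimes> x \<otimes> g"
    have zG: "z \<in> carrier G"
      using xG gf by (simp add: z_def)
    have "z \<in> S"
      using conjS[OF x inv_closed[OF gf(2)]] gf(2) by (simp add: z_def)
    then have zf: "z \<otimes> f = f \<otimes> z"
      using comm_conj gf(3) by (auto simp: S_def)
    have xz: "x = g \<otimes> z \<otimes> inv g"
      using conjugation_is_surj[OF gf(2) xG] by (simp add: z_def)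
    have "(g \<otimes> a \<otimes> inv g) \<otimes> (g \<otimes> b \<otimes> inv g) = g \<otimes> (a \<otimes> b) \<otimes> inv g"
      if "a \<in> carrier G" "b \<in> carrier G" for a b
      using that gf(2) by (simp add: m_assoc inv_solve_left')
    then show ?thesis
      unfolding xz gf(1) using zf zG fG by simp
  qed
  then have "commutative_subgroup G (generate G S)"
    using SG by (intro commutative_subgroup_generate)
  moreover have "generate G S \<lhd> G"
    using SG conjS by (rule normal_generateI)
  moreover have "E \<subseteq> generate G S"
  proof
    fix e assume e: "e \<in> E"
    then have "e = \<one> \<otimes> e \<otimes> inv \<one>"
      using EG by simp
    then have "e \<in> S"
      using e unfolding S_def by blast
    then show "e \<in> generate G S"
      by (rule generate.incl)
  qed
  ultimately show ?thesis
    using that by blast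
qed

end

section \<open>Fixed spaces and quadratic action\<close>

context FpG_module
begin

section \<open>Additivity of the action and pointwise stabilizers\<close>

lemma act_closed [simp]:
  "\<lbrakk>v \<in> carrier V; g \<in> carrier G\<rbrakk> \<Longrightarrow> act v g \<in> carrier V"
  using act_linear[of g] by (auto simp: module_hom_def)

lemma act_add:
  "\<lbrakk>u \<in> carrier V; v \<in> carrier V; g \<in> carrier G\<rbrakk>
    \<Longrightarrow> act (u \<oplus>\<^bsub>V\<^esub> v) g = act u g \<oplus>\<^bsub>V\<^esub> act v g"
  using act_linear[of g] by (auto simp: module_hom_def)

lemma act_group_hom:
  assumes "g \<in> carrier G"
  shows "group_hom (add_monoid V) (add_monoid V) (\<lambda>v. act v g)"
proof -
  have "(\<lambda>v. act v g) \<in> hom (add_monoid V) (add_monoid V)"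
    using assms by (auto intro!: homI simp: act_add)
  then show ?thesis
    using M.add.is_group by (simp add: group_hom_def group_hom_axioms_def)
qed

lemma act_minus:
  assumes "u \<in> carrier V" "v \<in> carrier V" "g \<in> carrier G"
  shows "act (u \<ominus>\<^bsub>V\<^esub> v) g = act u g \<ominus>\<^bsub>V\<^esub> act v g"
proof -
  have "act (\<ominus>\<^bsub>V\<^esub> v) g = \<ominus>\<^bsub>V\<^esub> act v g"
    using group_hom.hom_inv[OF act_group_hom[OF assms(3)]] assms by (simp add: a_inv_def)
  then show ?thesis
    using assms by (simp add: M.minus_eq act_add)
qed

lemma act_inv_cancel:
  assumes "v \<in> carrier V" "g \<in> carrier G"
  shows "act (act v g) (inv\<^bsub>G\<^esub> g) = v" "act (act v (inv\<^bsub>G\<^esub> g)) g = v"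
  using assms act_mult[of v g "inv\<^bsub>G\<^esub> g"] act_mult[of v "inv\<^bsub>G\<^esub> g" g] by (simp_all add: act_one)

text \<open>Phrased in the additive group of \<open>V\<close>, so that the count for products of
  subgroups applies to sums of fixed spaces.\<close>

lemma subgroup_fixed_space:
  assumes "H \<subseteq> carrier G"
  shows "subgroup (fixed_space V act H) (add_monoid V)"
proof (rule M.add.subgroupI)
  have "act \<zero>\<^bsub>V\<^esub> g = \<zero>\<^bsub>V\<^esub>" if "g \<in> carrier G" for g
    using group_hom.hom_one[OF act_group_hom[OF that]] by simp
  then have "\<zero>\<^bsub>V\<^esub> \<in> fixed_space V act H"
    using assms by (auto simp: fixed_space_def)
  then show "fixed_space V act H \<noteq> {}"
    by blast
next
  fix a assume a: "a \<in> fixed_space V act H"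
  have "act (\<ominus>\<^bsub>V\<^esub> a) h = \<ominus>\<^bsub>V\<^esub> a" if "h \<in> H" for h
  proof -
    have "h \<in> carrier G" "a \<in> carrier V" "act a h = a"
      using assms that a by (auto simp: fixed_space_def)
    then show ?thesis
      using group_hom.hom_inv[OF act_group_hom, of h a] by (simp add: a_inv_def)
  qed
  with a show "\<ominus>\<^bsub>V\<^esub> a \<in> fixed_space V act H"
    by (auto simp: fixed_space_def)
next
  fix a b assume "a \<in> fixed_space V act H" "b \<in> fixed_space V act H"
  then show "a \<oplus>\<^bsub>V\<^esub> b \<in> fixed_space V act H"
    using assms act_add[of a b] by (auto simp: fixed_space_def)
qed (auto simp: fixed_space_def)

text \<open>Serves both for the centralizer \<open>B\<close> in the replacement argument and for the
  kernel of the action on an invariant subspace.\<close>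

lemma subgroup_fixer:
  assumes H: "subgroup H G" and U: "U \<subseteq> carrier V"
  shows "subgroup {h \<in> H. \<forall>u\<in>U. act u h = u} G"
proof (rule subgroupI)
  have HG: "h \<in> carrier G" if "h \<in> H" for h
    using H that by (rule subgroup.mem_carrier)
  show "{h \<in> H. \<forall>u\<in>U. act u h = u} \<subseteq> carrier G"
    using HG by blast
  have "\<one>\<^bsub>G\<^esub> \<in> {h \<in> H. \<forall>u\<in>U. act u h = u}"
    using U subgroup.one_closed[OF H] by (auto simp: act_one)
  then show "{h \<in> H. \<forall>u\<in>U. act u h = u} \<noteq> {}"
    by blast
  show "inv\<^bsub>G\<^esub> a \<in> {h \<in> H. \<forall>u\<in>U. act u h = u}"
    if a: "a \<in> {h \<in> H. \<forall>u\<in>U. act u h = u}" for a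
  proof -
    have "act u (inv\<^bsub>G\<^esub> a) = u" if u: "u \<in> U" for u
      using act_inv_cancel(1)[of u a] a u U HG by auto
    then show ?thesis
      using a subgroup.m_inv_closed[OF H] by blast
  qed
  show "a \<otimes>\<^bsub>G\<^esub> b \<in> {h \<in> H. \<forall>u\<in>U. act u h = u}"
    if ab: "a \<in> {h \<in> H. \<forall>u\<in>U. act u h = u}" "b \<in> {h \<in> H. \<forall>u\<in>U. act u h = u}" for a b
  proof -
    have "act u (a \<otimes>\<^bsub>G\<^esub> b) = u" if u: "u \<in> U" for u
      using act_mult[of u a b] ab u U HG by auto
    then show ?thesis
      using ab subgroup.m_closed[OF H] by blast
  qed
qed

section \<open>Scalars modulo \<open>p\<close> and doubled vectors\<close>

text \<open>Carries congruences of natural numbers over to \<open>V\<close>: a multiple of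
  \<open>v\<close> depends only on the residue of \<open>k\<close> modulo \<open>p\<close>.\<close>

lemma add_pow_eq_smult:
  assumes v: "v \<in> carrier V" and p: "p > 1"
  shows "[k] \<cdot>\<^bsub>V\<^esub> v = (int (k mod p)) \<odot>\<^bsub>V\<^esub> v"
proof (induction k)
  case 0
  have "\<zero>\<^bsub>residue_ring (int p)\<^esub> \<odot>\<^bsub>V\<^esub> v = \<zero>\<^bsub>V\<^esub>"
    using v by simp
  then show ?case
    using v by (simp add: residue_ring_def)
next
  case (Suc k)
  have 1: "1 \<odot>\<^bsub>V\<^esub> v = v"
  proof -
    have "\<one>\<^bsub>residue_ring (int p)\<^esub> = 1"
      by (simp add: residue_ring_def)
    with smult_one[OF v] show ?thesis
      by metis
  qed
  have "k mod p < p"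
    using p by simp
  then have "int (k mod p) \<in> carrier (residue_ring (int p))" "1 \<in> carrier (residue_ring (int p))"
    using p unfolding residue_ring_def partial_object.simps atLeastAtMost_iff by linarith+
  then have "(int (k mod p) \<oplus>\<^bsub>residue_ring (int p)\<^esub> 1) \<odot>\<^bsub>V\<^esub> v
      = int (k mod p) \<odot>\<^bsub>V\<^esub> v \<oplus>\<^bsub>V\<^esub> v"
    using smult_l_distr v 1 by metis
  moreover have "int (k mod p) \<oplus>\<^bsub>residue_ring (int p)\<^esub> 1 = int (Suc k mod p)"
    by (simp add: residue_ring_def zmod_int mod_simps ac_simps)
  ultimately show ?case
    using Suc v by simp
qed

text \<open>With \<open>q = |G|\<close>, Fermat gives \<open>u = u g\<^sup>q = 2\<^sup>q u = 2 u\<close>.\<close>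

lemma eq_zero_of_act_eq_double:
  assumes p: "Factorial_Ring.prime p" and order: "order G = p ^ n"
    and u: "u \<in> carrier V" and g: "g \<in> carrier G" and ug: "act u g = u \<oplus>\<^bsub>V\<^esub> u"
  shows "u = \<zero>\<^bsub>V\<^esub>"
proof -
  have double: "[(2::nat)] \<cdot>\<^bsub>V\<^esub> u = u \<oplus>\<^bsub>V\<^esub> u"
    using M.add.nat_pow_mult[OF u, of 1 1] M.add.nat_pow_eone[OF u]
    unfolding one_add_one by (simp only:)
  have pow: "act u (g [^]\<^bsub>G\<^esub> k) = [(2 ^ k :: nat)] \<cdot>\<^bsub>V\<^esub> u" for k :: nat
  proof (induction k)
    case 0
    then show ?case using u by (simp add: act_one)
  next
    case (Suc k)
    have "act u (g [^]\<^bsub>G\<^esub> Suc k) = act ([(2 ^ k :: nat)] \<cdot>\<^bsub>V\<^esub> u) g"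
      using Suc u g by (simp add: act_mult)
    also have "\<dots> = [(2 ^ k :: nat)] \<cdot>\<^bsub>V\<^esub> (act u g)"
      using group_hom.hom_nat_pow[OF act_group_hom[OF g], of u "2 ^ k"] u
      by (simp add: add_pow_def)
    also have "\<dots> = [(2 ^ k * 2 :: nat)] \<cdot>\<^bsub>V\<^esub> u"
      using u by (metis M.add.nat_pow_pow double mult.commute ug)
    finally show ?case by (simp add: mult.commute)
  qed
  have "p > 1"
    using p by (rule prime_gt_1_nat)
  have "u = [(2 ^ (p ^ n) :: nat)] \<cdot>\<^bsub>V\<^esub> u"
    using pow[of "p ^ n"] pow_order_eq_1[OF g] order u by (simp add: act_one)
  also have "\<dots> = [(2::nat)] \<cdot>\<^bsub>V\<^esub> u"
    using cong_power_prime_power[OF p, of 2 n] u \<open>p > 1\<close>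
    by (simp only: add_pow_eq_smult cong_def)
  finally have "u = u \<oplus>\<^bsub>V\<^esub> u"
    using double by simp
  then show ?thesis
    using u by (metis M.add.l_cancel_one')
qed

section \<open>Weights and the replacement argument\<close>

text \<open>The numerator of \<open>j_ratio\<close> as a natural number, so that subgroups can be
  compared without dividing by the size of \<open>V\<close>.\<close>

definition weight :: "'g set \<Rightarrow> nat" where
  "weight H = card H * card (fixed_space V act H)"

lemma weight_one: "weight {\<one>\<^bsub>G\<^esub>} = card (carrier V)"
proof -
  have "fixed_space V act {\<one>\<^bsub>G\<^esub>} = carrier V"
    by (auto simp: fixed_space_def act_one)
  then show ?thesis
    by (simp add: weight_def)
qed

lemma finite_fixed_space: "finite (carrier V) \<Longrightarrow> finite (fixed_space V act H)"
  by (simp add: fixed_space_def)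

text \<open>A variant of Thompson's replacement argument.  For \<open>v \<in> V\<close> put \<open>d a = v (a - 1)\<close> and let
  \<open>B\<close> be the centralizer in \<open>F\<close> of \<open>d F\<close>.  As \<open>F\<close> is abelian, \<open>d a\<close> and \<open>d b\<close> agree modulo \<open>C\<^sub>V(F)\<close>
  only if \<open>a b\<^sup>-\<^sup>1 \<in> B\<close>, so the set \<open>W = d F + C\<^sub>V(F)\<close>, which lies in \<open>C\<^sub>V(B)\<close>, has at least
  \<open>|F : B| |C\<^sub>V(F)|\<close> elements.  Hence \<open>B\<close> has maximal weight, and \<open>B = F\<close> unless \<open>B = 1\<close>
  and \<open>W = V\<close>.  In the latter case \<open>v = d a + c\<close>, so \<open>a\<close> doubles \<open>d a\<close> and \<open>v = c\<close> is fixed by \<open>F\<close>.\<close>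

lemma quadratic_replacement:
  assumes p: "Factorial_Ring.prime p" and order: "order G = p ^ n"
    and finG: "finite (carrier G)" and finV: "finite (carrier V)"
    and F: "commutative_subgroup G F" "F \<noteq> {\<one>\<^bsub>G\<^esub>}"
    and max: "\<And>B. subgroup B G \<Longrightarrow> B \<subseteq> F \<Longrightarrow> weight B \<le> weight F"
    and min: "\<And>B. \<lbrakk>subgroup B G; B \<subseteq> F; B \<noteq> {\<one>\<^bsub>G\<^esub>}; weight B = weight F\<rbrakk> \<Longrightarrow> B = F"
    and v: "v \<in> carrier V" and x: "x \<in> F" and y: "y \<in> F"
  shows "act (act v x \<ominus>\<^bsub>V\<^esub> v) y = act v x \<ominus>\<^bsub>V\<^esub> v"
proof -
  have subF: "subgroup F G"
    using F(1) by (simp add: commutative_subgroup_def)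
  have FG: "a \<in> carrier G" if "a \<in> F" for a
    using subF that by (rule subgroup.mem_carrier)
  define C where "C = fixed_space V act F"
  have subC: "subgroup C (add_monoid V)"
    unfolding C_def using subgroup.subset[OF subF] by (rule subgroup_fixed_space)
  have C: "c \<in> carrier V" "act c a = c" if "c \<in> C" "a \<in> F" for c a
    using that by (auto simp: C_def fixed_space_def)
  have CV: "c \<in> carrier V" if "c \<in> C" for c
    using that by (auto simp: C_def fixed_space_def)
  define d where "d a = act v a \<ominus>\<^bsub>V\<^esub> v" for a
  have dV: "d a \<in> carrier V" if "a \<in> F" for a
    using v FG that by (simp add: d_def)
  have d_eq: "act v a = d a \<oplus>\<^bsub>V\<^esub> v" if "a \<in> F" for a
    using v FG[OF that] by (simp add: d_def M.minus_eq M.a_assoc M.l_neg)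
  define B where "B = {b \<in> F. \<forall>u\<in>d ` F. act u b = u}"
  have subB: "subgroup B G"
    unfolding B_def using subF by (rule subgroup_fixer) (auto intro: dV)
  have BF: "B \<subseteq> F"
    by (auto simp: B_def)
  define f where "f w = d (fst w) \<oplus>\<^bsub>V\<^esub> snd w" for w
  define W where "W = f ` (F \<times> C)"
  have WV: "W \<subseteq> carrier V"
    by (auto simp: W_def f_def dV CV)
  have finF: "finite F"
    using subgroup.subset[OF subF] finG by (rule finite_subset)
  have finC: "finite C"
    using finV by (simp add: C_def finite_fixed_space)
  \<comment> \<open>Add \<open>v\<close> to the equation to get \<open>v a + c = v b + c'\<close>,
    then apply \<open>z\<close>. Since \<open>z\<close> commutes with \<open>a\<close> and
    \<open>b\<close> and fixes \<open>c\<close> and \<open>c'\<close>, this gives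
    \<open>(v z) a + c = (v z) b + c'\<close>; subtracting the two equations leaves the
    claim.\<close>
  have transfer: "act (d z) a = act (d z) b"
    if ab: "a \<in> F" "b \<in> F" and cc: "c \<in> C" "c' \<in> C"
      and eq: "d a \<oplus>\<^bsub>V\<^esub> c = d b \<oplus>\<^bsub>V\<^esub> c'" and z: "z \<in> F" for a b c c' z
  proof -
    note G = FG[OF ab(1)] FG[OF ab(2)] FG[OF z] and c = CV[OF cc(1)] CV[OF cc(2)]
    have "act v a \<oplus>\<^bsub>V\<^esub> c = v \<oplus>\<^bsub>V\<^esub> (d a \<oplus>\<^bsub>V\<^esub> c)"
      using dV ab c v by (simp add: d_eq M.a_ac)
    also have "\<dots> = act v b \<oplus>\<^bsub>V\<^esub> c'"
      unfolding eq using dV ab c v by (simp add: d_eq M.a_ac)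
    finally have 1: "act v a \<oplus>\<^bsub>V\<^esub> c = act v b \<oplus>\<^bsub>V\<^esub> c'" .
    have 2: "act (act v z) a \<oplus>\<^bsub>V\<^esub> c = act (act v a \<oplus>\<^bsub>V\<^esub> c) z" if "a \<in> F" "c \<in> C" for a c
    proof -
      have "act (act v z) a = act (act v a) z"
        using commutative_subgroup_commute[OF F(1) z that(1)] act_mult v FG[OF that(1)] G(3)
        by metis
      then show ?thesis
        using v C(2)[OF that(2) z] CV[OF that(2)] FG[OF that(1)] G(3) by (simp add: act_add)
    qed
    have 3: "act (d z) a = (act (act v z) a \<oplus>\<^bsub>V\<^esub> c) \<ominus>\<^bsub>V\<^esub> (act v a \<oplus>\<^bsub>V\<^esub> c)" if "a \<in> F" "c \<in> C" for a c
      using v FG[OF that(1)] G(3) CV[OF that(2)] by (simp add: d_def act_minus M.add_diff_cancel)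
    show ?thesis
      using 1 2[OF ab(1) cc(1)] 2[OF ab(2) cc(2)] 3[OF ab(1) cc(1)] 3[OF ab(2) cc(2)] by simp
  qed
  \<comment> \<open>On a fibre of \<open>f\<close> the first component determines the second. By
    \<open>transfer\<close>, quotients of first components centralize \<open>d F\<close>, so they
    lie in \<open>B\<close>.\<close>
  have fibre: "card {u \<in> F \<times> C. f u = f w} \<le> card B" if w: "w \<in> F \<times> C" for w
  proof (rule card_inj_on_le[where f = "\<lambda>u. fst u \<otimes>\<^bsub>G\<^esub> inv\<^bsub>G\<^esub> (fst w)"])
    have wF: "fst w \<in> F" "snd w \<in> C"
      using w by auto
    show "inj_on (\<lambda>u. fst u \<otimes>\<^bsub>G\<^esub> inv\<^bsub>G\<^esub> (fst w)) {u \<in> F \<times> C. f u = f w}"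
    proof (rule inj_onI)
      fix s t
      assume s: "s \<in> {u \<in> F \<times> C. f u = f w}" and t: "t \<in> {u \<in> F \<times> C. f u = f w}"
        and eq: "fst s \<otimes>\<^bsub>G\<^esub> inv\<^bsub>G\<^esub> (fst w) = fst t \<otimes>\<^bsub>G\<^esub> inv\<^bsub>G\<^esub> (fst w)"
      have st: "fst s \<in> F" "fst t \<in> F" "snd s \<in> C" "snd t \<in> C" "f s = f t"
        using s t by auto
      have fst: "fst s = fst t"
        using eq FG[OF st(1)] FG[OF st(2)] FG[OF wF(1)] by (meson inv_closed right_cancel)
      moreover have "snd s = snd t"
        using st(5) M.add.l_cancel[of "d (fst t)" "snd s" "snd t"] dV[OF st(2)] CV[OF st(3)] CV[OF st(4)]
        unfolding f_def fst by blast
      ultimately show "s = t"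
        by (rule prod_eqI)
    qed
    have "fst u \<otimes>\<^bsub>G\<^esub> inv\<^bsub>G\<^esub> (fst w) \<in> B" if u: "u \<in> F \<times> C" "f u = f w" for u
    proof -
      have uF: "fst u \<in> F" "snd u \<in> C"
        using u by auto
      have "act (d z) (fst u \<otimes>\<^bsub>G\<^esub> inv\<^bsub>G\<^esub> (fst w)) = d z" if z: "z \<in> F" for z
      proof -
        have "act (d z) (fst u \<otimes>\<^bsub>G\<^esub> inv\<^bsub>G\<^esub> (fst w)) = act (act (d z) (fst u)) (inv\<^bsub>G\<^esub> (fst w))"
          using dV[OF z] FG[OF uF(1)] FG[OF wF(1)] by (simp add: act_mult)
        also have "act (d z) (fst u) = act (d z) (fst w)"
          using u(2) uF wF z by (intro transfer) (auto simp: f_def)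
        also have "act (act (d z) (fst w)) (inv\<^bsub>G\<^esub> (fst w)) = d z"
          using dV[OF z] FG[OF wF(1)] by (rule act_inv_cancel)
        finally show ?thesis .
      qed
      moreover have "fst u \<otimes>\<^bsub>G\<^esub> inv\<^bsub>G\<^esub> (fst w) \<in> F"
        using uF wF by (intro subgroup.m_closed[OF subF] subgroup.m_inv_closed[OF subF])
      ultimately show ?thesis
        by (auto simp: B_def)
    qed
    then show "(\<lambda>u. fst u \<otimes>\<^bsub>G\<^esub> inv\<^bsub>G\<^esub> (fst w)) ` {u \<in> F \<times> C. f u = f w} \<subseteq> B"
      by blast
    show "finite B"
      using BF finF by (rule finite_subset)
  qed
  have le_W: "weight F \<le> card W * card B"
  proof -
    have "card (F \<times> C) \<le> card (f ` (F \<times> C)) * card B"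
      using finF finC fibre by (intro card_le_card_image_mult) auto
    then show ?thesis
      by (simp add: weight_def W_def C_def card_cartesian_product)
  qed
  \<comment> \<open>\<open>B\<close> fixes \<open>d F\<close> by definition and \<open>C\<close>
    because \<open>B\<close> is contained in \<open>F\<close>.\<close>
  have W_fixed: "W \<subseteq> fixed_space V act B"
  proof
    fix u assume "u \<in> W"
    then obtain a c where u: "u = d a \<oplus>\<^bsub>V\<^esub> c" "a \<in> F" "c \<in> C"
      by (auto simp: W_def f_def)
    have "act u b = u" if b: "b \<in> B" for b
    proof -
      have "b \<in> F" "act (d a) b = d a"
        using b u(2) by (auto simp: B_def)
      then show ?thesis
        using u dV[OF u(2)] CV[OF u(3)] C(2)[OF u(3)] FG by (simp add: act_add)
    qed
    then show "u \<in> fixed_space V act B"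
      using \<open>u \<in> W\<close> WV by (auto simp: fixed_space_def)
  qed
  have "card W \<le> card (fixed_space V act B)"
    using W_fixed finV by (intro card_mono finite_fixed_space)
  then have "card W * card B \<le> weight B"
    by (simp add: weight_def)
  with le_W max[OF subB BF] have wB: "weight B = weight F"
    by linarith
  have "B = F"
  proof (cases "B = {\<one>\<^bsub>G\<^esub>}")
    case False
    then show ?thesis
      using min[OF subB BF] wB by blast
  next
    case True
    \<comment> \<open>For trivial \<open>B\<close>, the weight of \<open>B\<close> is the size of
      \<open>V\<close>, and \<open>le_W\<close> loses its factor \<open>card B\<close>.\<close>
    have "card (carrier V) \<le> card W"
      using le_W wB weight_one unfolding True by simp
    then have "W = carrier V"
      using WV finV by (intro card_seteq) auto
    then have "v \<in> W"
      using v by simp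
    then obtain a c where va: "v = d a \<oplus>\<^bsub>V\<^esub> c" "a \<in> F" "c \<in> C"
      by (auto simp: W_def f_def)
    note aG = FG[OF va(2)] and cV = CV[OF va(3)]
    \<comment> \<open>Expand \<open>v a\<close> in two ways: as \<open>d a + v\<close>, and by
      applying \<open>a\<close> to \<open>v = d a + c\<close>. Substituting for \<open>v\<close> and
      cancelling \<open>c\<close> leaves the doubling relation.\<close>
    have "d a \<oplus>\<^bsub>V\<^esub> v = act v a"
      using d_eq[OF va(2)] by simp
    also have "\<dots> = act (d a) a \<oplus>\<^bsub>V\<^esub> c"
      using arg_cong[OF va(1), of "\<lambda>u. act u a"] act_add[OF dV[OF va(2)] cV aG] C(2)[OF va(3) va(2)]
      by simp
    finally have "(d a \<oplus>\<^bsub>V\<^esub> d a) \<oplus>\<^bsub>V\<^esub> c = act (d a) a \<oplus>\<^bsub>V\<^esub> c"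
      using va(1) dV[OF va(2)] cV by (simp add: M.a_assoc)
    then have "act (d a) a = d a \<oplus>\<^bsub>V\<^esub> d a"
      using dV[OF va(2)] cV aG M.add.r_cancel by (metis M.a_closed act_closed)
    then have "d a = \<zero>\<^bsub>V\<^esub>"
      using eq_zero_of_act_eq_double[OF p order dV[OF va(2)] aG] by blast
    then have "v = c"
      using va(1) cV by simp
    \<comment> \<open>Now \<open>v\<close> is fixed by \<open>F\<close>, so \<open>d\<close>
      vanishes on \<open>F\<close>, and all of \<open>F\<close> centralizes \<open>d F\<close>. Thus
      \<open>B = F\<close> in this case too.\<close>
    then have "d z = \<zero>\<^bsub>V\<^esub>" if "z \<in> F" for z
      using C(2)[OF va(3) that] v by (simp add: d_def M.minus_eq M.r_neg)
    moreover have "act \<zero>\<^bsub>V\<^esub> b = \<zero>\<^bsub>V\<^esub>" if "b \<in> F" for b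
      using group_hom.hom_one[OF act_group_hom[OF FG[OF that]]] by simp
    ultimately show ?thesis
      by (auto simp: B_def)
  qed
  then show ?thesis
    using x y unfolding B_def d_def by blast
qed

section \<open>Weights of products and conjugates\<close>

text \<open>Multiply two product counts, one for \<open>H\<close> and \<open>K\<close> in
  \<open>G\<close> and one for their fixed spaces in \<open>V\<close>. A vector fixed by
  \<open>H\<close> and by \<open>K\<close> is fixed by \<open>H K\<close>.\<close>

lemma weight_mult_le:
  assumes finG: "finite (carrier G)" and finV: "finite (carrier V)"
    and H: "subgroup H G" and K: "subgroup K G"
  shows "weight H * weight K \<le> weight (H <#>\<^bsub>G\<^esub> K) *
    (card (H \<inter> K) * card (fixed_space V act H <#>\<^bsub>add_monoid V\<^esub> fixed_space V act K))"
proof -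
  let ?C = "fixed_space V act" and ?S = "fixed_space V act H <#>\<^bsub>add_monoid V\<^esub> fixed_space V act K"
  have HG: "H \<subseteq> carrier G" and KG: "K \<subseteq> carrier G"
    using H K by (blast dest: subgroup.subset)+
  have fin: "finite H" "finite K"
    using HG KG finG by (blast intro: finite_subset)+
  have 1: "card H * card K \<le> card (H <#>\<^bsub>G\<^esub> K) * card (H \<inter> K)"
    using H K fin by (rule card_mult_le_card_set_mult)
  have 2: "card (?C H) * card (?C K) \<le> card ?S * card (?C H \<inter> ?C K)"
    using HG KG finV
    by (intro M.add.card_mult_le_card_set_mult subgroup_fixed_space finite_fixed_space)
  have "?C H \<inter> ?C K \<subseteq> ?C (H <#>\<^bsub>G\<^esub> K)"
    using HG KG by (auto simp: fixed_space_def set_mult_def act_mult subset_eq)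
  then have "card (?C H \<inter> ?C K) \<le> card (?C (H <#>\<^bsub>G\<^esub> K))"
    using finV by (intro card_mono finite_fixed_space)
  then have 3: "card ?S * card (?C H \<inter> ?C K) \<le> card ?S * card (?C (H <#>\<^bsub>G\<^esub> K))"
    by simp
  have "weight H * weight K = (card H * card K) * (card (?C H) * card (?C K))"
    by (simp add: weight_def)
  also have "\<dots> \<le> (card (H <#>\<^bsub>G\<^esub> K) * card (H \<inter> K)) * (card ?S * card (?C (H <#>\<^bsub>G\<^esub> K)))"
    using 1 order_trans[OF 2 3] by (rule mult_le_mono)
  also have "\<dots> = weight (H <#>\<^bsub>G\<^esub> K) * (card (H \<inter> K) * card ?S)"
    by (simp add: weight_def)
  finally show ?thesis .
qed

text \<open>Since the action is on the right, \<open>v \<mapsto> v g\<close> maps the fixed space of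
  \<open>g H g^-1\<close> bijectively onto that of \<open>H\<close>.\<close>

lemma weight_conj:
  assumes H: "H \<subseteq> carrier G" and g: "g \<in> carrier G"
  shows "weight ((\<lambda>h. g \<otimes>\<^bsub>G\<^esub> h \<otimes>\<^bsub>G\<^esub> inv\<^bsub>G\<^esub> g) ` H) = weight H"
proof -
  let ?H = "(\<lambda>h. g \<otimes>\<^bsub>G\<^esub> h \<otimes>\<^bsub>G\<^esub> inv\<^bsub>G\<^esub> g) ` H"
  have "inj_on (\<lambda>h. g \<otimes>\<^bsub>G\<^esub> h \<otimes>\<^bsub>G\<^esub> inv\<^bsub>G\<^esub> g) H"
    using H g conjugation_is_inj by (blast intro: inj_onI)
  then have 1: "card ?H = card H"
    by (rule card_image)
  have act_conj: "act v (g \<otimes>\<^bsub>G\<^esub> h \<otimes>\<^bsub>G\<^esub> inv\<^bsub>G\<^esub> g) = v \<longleftrightarrow> act (act v g) h = act v g"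
    if "v \<in> carrier V" "h \<in> carrier G" for v h
  proof -
    have "act v (g \<otimes>\<^bsub>G\<^esub> h \<otimes>\<^bsub>G\<^esub> inv\<^bsub>G\<^esub> g) = act (act (act v g) h) (inv\<^bsub>G\<^esub> g)"
      using that g by (simp add: act_mult)
    then show ?thesis
      using that g act_inv_cancel by (metis act_closed)
  qed
  have "bij_betw (\<lambda>v. act v g) (fixed_space V act ?H) (fixed_space V act H)"
  proof (rule bij_betw_byWitness[where f' = "\<lambda>v. act v (inv\<^bsub>G\<^esub> g)"])
    show "(\<lambda>v. act v g) ` fixed_space V act ?H \<subseteq> fixed_space V act H"
      using H g act_conj by (auto simp: fixed_space_def subset_eq)
    show "(\<lambda>v. act v (inv\<^bsub>G\<^esub> g)) ` fixed_space V act H \<subseteq> fixed_space V act ?H"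
      using H g act_conj act_inv_cancel(2) by (auto simp: fixed_space_def subset_eq)
  qed (use g act_inv_cancel in \<open>auto simp: fixed_space_def\<close>)
  then have "card (fixed_space V act ?H) = card (fixed_space V act H)"
    by (rule bij_betw_same_card)
  with 1 show ?thesis
    by (simp add: weight_def)
qed

section \<open>Trivial action on \<open>W\<close> and on \<open>V / W\<close>\<close>

text \<open>The set is the intersection of the kernels of the actions on \<open>W\<close> and on
  \<open>V / W\<close>, described by elements without forming the quotient.\<close>

lemma normal_trivial_on_factors:
  assumes W: "subgroup W (add_monoid V)"
    and inv: "\<And>w g. w \<in> W \<Longrightarrow> g \<in> carrier G \<Longrightarrow> act w g \<in> W"
  shows "{x \<in> carrier G. (\<forall>w\<in>W. act w x = w) \<and> (\<forall>v\<in>carrier V. act v x \<ominus>\<^bsub>V\<^esub> v \<in> W)} \<lhd> G"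
    (is "?N \<lhd> G")
proof -
  have WV: "w \<in> carrier V" if "w \<in> W" for w
    using subgroup.mem_carrier[OF W that] by simp
  have zero: "\<zero>\<^bsub>V\<^esub> \<in> W" and add: "\<And>u w. u \<in> W \<Longrightarrow> w \<in> W \<Longrightarrow> u \<oplus>\<^bsub>V\<^esub> w \<in> W"
    and minus: "\<And>w. w \<in> W \<Longrightarrow> \<ominus>\<^bsub>V\<^esub> w \<in> W"
    using subgroup.one_closed[OF W] subgroup.m_closed[OF W] subgroup.m_inv_closed[OF W]
    by (auto simp: a_inv_def)
  have sub1: "subgroup {x \<in> carrier G. \<forall>w\<in>W. act w x = w} G"
    using WV by (intro subgroup_fixer subgroup_self) auto
  have "subgroup ?N G"
  proof (rule subgroupI)
    show "?N \<subseteq> carrier G"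
      by auto
    have "\<one>\<^bsub>G\<^esub> \<in> ?N"
      using WV zero by (auto simp: act_one M.minus_eq M.r_neg)
    then show "?N \<noteq> {}"
      by blast
  next
    fix a assume a: "a \<in> ?N"
    then have aG: "a \<in> carrier G"
      by simp
    have "act v (inv\<^bsub>G\<^esub> a) \<ominus>\<^bsub>V\<^esub> v \<in> W" if v: "v \<in> carrier V" for v
    proof -
      let ?u = "act v (inv\<^bsub>G\<^esub> a)"
      have u: "?u \<in> carrier V"
        using v aG by simp
      then have "\<ominus>\<^bsub>V\<^esub> (act ?u a \<ominus>\<^bsub>V\<^esub> ?u) \<in> W"
        using a minus by blast
      also have "act ?u a = v"
        using v aG by (rule act_inv_cancel)
      also have "\<ominus>\<^bsub>V\<^esub> (v \<ominus>\<^bsub>V\<^esub> ?u) = ?u \<ominus>\<^bsub>V\<^esub> v"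
        using u v by (simp add: M.minus_eq M.minus_add M.a_comm)
      finally show ?thesis .
    qed
    moreover have "inv\<^bsub>G\<^esub> a \<in> {x \<in> carrier G. \<forall>w\<in>W. act w x = w}"
      using a by (intro subgroup.m_inv_closed[OF sub1]) auto
    ultimately show "inv\<^bsub>G\<^esub> a \<in> ?N"
      by auto
  next
    fix a b assume a: "a \<in> ?N" and b: "b \<in> ?N"
    then have G: "a \<in> carrier G" "b \<in> carrier G"
      by auto
    have "act v (a \<otimes>\<^bsub>G\<^esub> b) \<ominus>\<^bsub>V\<^esub> v \<in> W" if v: "v \<in> carrier V" for v
    proof -
      have va: "act v a \<in> carrier V" and vab: "act (act v a) b \<in> carrier V"
        using v G by simp_all
      have "act v a \<ominus>\<^bsub>V\<^esub> v \<in> W" "act (act v a) b \<ominus>\<^bsub>V\<^esub> act v a \<in> W"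
        using a b v va by auto
      then have "(act (act v a) b \<ominus>\<^bsub>V\<^esub> act v a) \<oplus>\<^bsub>V\<^esub> (act v a \<ominus>\<^bsub>V\<^esub> v) \<in> W"
        by (intro add)
      also have "(act (act v a) b \<ominus>\<^bsub>V\<^esub> act v a) \<oplus>\<^bsub>V\<^esub> (act v a \<ominus>\<^bsub>V\<^esub> v)
          = act (act v a) b \<oplus>\<^bsub>V\<^esub> (\<ominus>\<^bsub>V\<^esub> act v a \<oplus>\<^bsub>V\<^esub> act v a) \<oplus>\<^bsub>V\<^esub> \<ominus>\<^bsub>V\<^esub> v"
        using v va vab by (simp add: M.minus_eq M.a_assoc del: M.l_neg M.r_neg M.add.l_inv)
      also have "\<dots> = act v (a \<otimes>\<^bsub>G\<^esub> b) \<ominus>\<^bsub>V\<^esub> v"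
        using v va vab G by (simp add: M.minus_eq M.l_neg act_mult)
      finally show ?thesis .
    qed
    moreover have "a \<otimes>\<^bsub>G\<^esub> b \<in> {x \<in> carrier G. \<forall>w\<in>W. act w x = w}"
      using a b by (intro subgroup.m_closed[OF sub1]) auto
    ultimately show "a \<otimes>\<^bsub>G\<^esub> b \<in> ?N"
      by auto
  qed
  moreover have "g \<otimes>\<^bsub>G\<^esub> x \<otimes>\<^bsub>G\<^esub> inv\<^bsub>G\<^esub> g \<in> ?N" if x: "x \<in> ?N" and g: "g \<in> carrier G" for x g
  proof -
    have xG: "x \<in> carrier G"
      using x by simp
    have conj: "act v (g \<otimes>\<^bsub>G\<^esub> x \<otimes>\<^bsub>G\<^esub> inv\<^bsub>G\<^esub> g) = act (act (act v g) x) (inv\<^bsub>G\<^esub> g)"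
      if "v \<in> carrier V" for v
      using that xG g by (simp add: act_mult)
    have "act w (g \<otimes>\<^bsub>G\<^esub> x \<otimes>\<^bsub>G\<^esub> inv\<^bsub>G\<^esub> g) = w" if w: "w \<in> W" for w
      using conj[OF WV[OF w]] inv[OF w g] x act_inv_cancel(1)[OF WV[OF w] g] by simp
    moreover have "act v (g \<otimes>\<^bsub>G\<^esub> x \<otimes>\<^bsub>G\<^esub> inv\<^bsub>G\<^esub> g) \<ominus>\<^bsub>V\<^esub> v \<in> W" if v: "v \<in> carrier V" for v
    proof -
      have vg: "act v g \<in> carrier V"
        using v g by simp
      \<comment> \<open>The difference for the conjugate is the image under \<open>g^-1\<close> of
        the difference for \<open>x\<close> at \<open>v g\<close>, so it stays in the invariant
        subspace \<open>W\<close>.\<close>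
      then have "act (act (act v g) x \<ominus>\<^bsub>V\<^esub> act v g) (inv\<^bsub>G\<^esub> g) \<in> W"
        using x g by (intro inv) auto
      also have "act (act (act v g) x \<ominus>\<^bsub>V\<^esub> act v g) (inv\<^bsub>G\<^esub> g)
          = act v (g \<otimes>\<^bsub>G\<^esub> x \<otimes>\<^bsub>G\<^esub> inv\<^bsub>G\<^esub> g) \<ominus>\<^bsub>V\<^esub> v"
        using vg v g xG act_inv_cancel(1)[OF v g] by (simp add: act_minus conj)
      finally show ?thesis .
    qed
    ultimately show ?thesis
      using xG g by auto
  qed
  ultimately show ?thesis
    by (rule normal_invI)
qed

section \<open>Quadratic central elements from heavy subgroups\<close>

text \<open>Turns the equation of sets into a pointwise one: \<open>g\<close> fixes every
  \<open>v g - v\<close>. That \<open>V\<close> is non-empty makes the set of double commutators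
  exactly \<open>{0}\<close> rather than just contained in it.\<close>

lemma quadratic_on_iff:
  "quadratic_on G V act g \<longleftrightarrow> g \<in> carrier G \<and> g \<noteq> \<one>\<^bsub>G\<^esub> \<and>
    (\<forall>v\<in>carrier V. act (act v g \<ominus>\<^bsub>V\<^esub> v) g = act v g \<ominus>\<^bsub>V\<^esub> v)"
proof (cases "g \<in> carrier G")
  case True
  let ?d = "\<lambda>v. act v g \<ominus>\<^bsub>V\<^esub> v"
  have "act_commutator V act (act_commutator V act (carrier V) g) g = (\<lambda>v. ?d (?d v)) ` carrier V"
    by (auto simp: act_commutator_def)
  also have "\<dots> = {\<zero>\<^bsub>V\<^esub>} \<longleftrightarrow> (\<forall>v\<in>carrier V. ?d (?d v) = \<zero>\<^bsub>V\<^esub>)"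
    using M.zero_closed by (auto simp: image_iff) force
  also have "\<dots> \<longleftrightarrow> (\<forall>v\<in>carrier V. act (?d v) g = ?d v)"
    using True by (intro ball_cong) (simp_all add: M.minus_other_side)
  finally show ?thesis
    using True by (simp add: quadratic_on_def)
qed (simp add: quadratic_on_def)

text \<open>Weights are maximized over all non-trivial subgroups of \<open>A\<close>. Conjugates of
  \<open>F\<close> remain in \<open>A\<close> by normality, and their products with \<open>F\<close>
  are subgroups by commutativity, so the maximum bounds these as well.\<close>

lemma quadratic_of_abelian_normal:
  assumes p: "Factorial_Ring.prime p" and order: "order G = p ^ n"
    and finG: "finite (carrier G)" and finV: "finite (carrier V)"
    and A: "A \<lhd> G" "commutative_subgroup G A"
    and E: "subgroup E G" "E \<subseteq> A" "E \<noteq> {\<one>\<^bsub>G\<^esub>}" "card (carrier V) \<le> weight E"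
  shows "\<exists>g \<in> Omega1 p G (group_center G). quadratic_on G V act g"
proof -
  define S where "S = {H. subgroup H G \<and> H \<subseteq> A \<and> H \<noteq> {\<one>\<^bsub>G\<^esub>}}"
  have AG: "A \<subseteq> carrier G"
    using A(2) by (auto simp: commutative_subgroup_def dest: subgroup.subset)
  have finA: "finite A"
    using AG finG by (rule finite_subset)
  have "S \<subseteq> Pow A"
    by (auto simp: S_def)
  then have finS: "finite S"
    using finA by (meson finite_Pow_iff finite_subset)
  have ES: "E \<in> S"
    using E by (simp add: S_def)
  define m where "m = Max (weight ` S)"
  have max: "weight H \<le> m" if "H \<in> S" for H
    unfolding m_def using finS that by (intro Max_ge) auto
  have "m \<in> weight ` S"
    unfolding m_def using finS ES by (intro Max_in) auto
  then obtain F0 where "F0 \<in> S \<and> weight F0 = m"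
    by auto
  then obtain F where F: "F \<in> S" "weight F = m"
    and F_least: "\<And>H. H \<in> S \<and> weight H = m \<Longrightarrow> card F \<le> card H"
    using ex_has_least_nat[of "\<lambda>H. H \<in> S \<and> weight H = m" F0 card] by auto
  have subF: "subgroup F G" and FA: "F \<subseteq> A" and F1: "F \<noteq> {\<one>\<^bsub>G\<^esub>}"
    using F by (auto simp: S_def)
  have FG: "F \<subseteq> carrier G" and finF: "finite F"
    using FA AG finA by (auto intro: finite_subset)
  have V_le_m: "card (carrier V) \<le> m"
    using E(4) max[OF ES] by simp
  have V_pos: "card (carrier V) > 0"
    using finV M.zero_closed card_gt_0_iff by blast
  \<comment> \<open>The trivial subgroup, which is not in \<open>S\<close>, has weight
    \<open>card (carrier V)\<close>, and \<open>E\<close> is at least as heavy.\<close>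
  have weight_le: "weight B \<le> m" if "subgroup B G" "B \<subseteq> A" for B
    using that max[of B] V_le_m weight_one by (cases "B = {\<one>\<^bsub>G\<^esub>}") (auto simp: S_def)
  \<comment> \<open>Maximality turns \<open>m \<le> weight B\<close> into equality, and
    \<open>F\<close> has least cardinality among the subgroups of weight \<open>m\<close>.\<close>
  have F_min: "B = F" if "subgroup B G" "B \<subseteq> F" "B \<noteq> {\<one>\<^bsub>G\<^esub>}" "m \<le> weight B" for B
  proof (rule card_seteq[OF finF that(2)])
    have "B \<in> S"
      using that FA by (auto simp: S_def)
    then show "card F \<le> card B"
      using that(4) max F_least by (metis le_antisym)
  qed
  have comm_A: "x \<otimes>\<^bsub>G\<^esub> y = y \<otimes>\<^bsub>G\<^esub> x" if "x \<in> A" "y \<in> A" for x y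
    using commutative_subgroup_commute[OF A(2) that] .
  have "comm_group (G\<lparr>carrier := F\<rparr>)"
    using comm_A FA by (intro group.group_comm_groupI[OF subgroup_imp_group[OF subF]]) auto
  then have commF: "commutative_subgroup G F"
    using subF by (simp add: commutative_subgroup_def)
  have quadF: "act (act v x \<ominus>\<^bsub>V\<^esub> v) y = act v x \<ominus>\<^bsub>V\<^esub> v"
    if "v \<in> carrier V" "x \<in> F" "y \<in> F" for v x y
  proof (rule quadratic_replacement[OF p order finG finV commF F1 _ _ that])
    show "weight B \<le> weight F" if "subgroup B G" "B \<subseteq> F" for B
      using weight_le[of B] that FA F(2) by auto
    show "B = F" if "subgroup B G" "B \<subseteq> F" "B \<noteq> {\<one>\<^bsub>G\<^esub>}" "weight B = weight F" for B
      using F_min[of B] that F(2) by simp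
  qed
  \<comment> \<open>This is \<open>[V, F, K] = 0\<close> for every conjugate \<open>K\<close> of
    \<open>F\<close>.\<close>
  have quad_conj: "act (act v x \<ominus>\<^bsub>V\<^esub> v) (g \<otimes>\<^bsub>G\<^esub> y \<otimes>\<^bsub>G\<^esub> inv\<^bsub>G\<^esub> g) = act v x \<ominus>\<^bsub>V\<^esub> v"
    if v: "v \<in> carrier V" and x: "x \<in> F" and y: "y \<in> F" and g: "g \<in> carrier G" for v x y g
  proof -
    let ?C = "fixed_space V act"
    define K where "K = (\<lambda>h. g \<otimes>\<^bsub>G\<^esub> h \<otimes>\<^bsub>G\<^esub> inv\<^bsub>G\<^esub> g) ` F"
    have "K = g <#\<^bsub>G\<^esub> F #>\<^bsub>G\<^esub> inv\<^bsub>G\<^esub> g"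
      by (auto simp: K_def l_coset_def r_coset_def)
    then have subK: "subgroup K G"
      using subgroup_conjugation_is_surj2[OF g subF] by simp
    have KA: "K \<subseteq> A"
      using FA g normal.inv_op_closed2[OF A(1)] by (auto simp: K_def)
    have KG: "K \<subseteq> carrier G"
      using KA AG by blast
    have yK: "g \<otimes>\<^bsub>G\<^esub> y \<otimes>\<^bsub>G\<^esub> inv\<^bsub>G\<^esub> g \<in> K"
      using y by (simp add: K_def)
    have wK: "weight K = m"
      unfolding K_def F(2)[symmetric] using FG g by (rule weight_conj)
    let ?S = "?C F <#>\<^bsub>add_monoid V\<^esub> ?C K"
    have SV: "?S \<subseteq> carrier V"
      by (auto simp: set_mult_def fixed_space_def)
    have "weight F * weight K \<le> weight (F <#>\<^bsub>G\<^esub> K) * (card (F \<inter> K) * card ?S)"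
      using finG finV subF subK by (rule weight_mult_le)
    also have "\<dots> \<le> m * (card (F \<inter> K) * card ?S)"
      using subgroup_set_mult_of_commutative[OF A(2) subF FA subK KA]
      by (intro mult_le_mono weight_le) auto
    \<comment> \<open>One factor \<open>m\<close> is cancelled; it is positive because it is at
      least the size of the non-empty finite \<open>V\<close>.\<close>
    finally have m_le: "m \<le> card (F \<inter> K) * card ?S"
      using F(2) wK V_le_m V_pos by simp
    have subFK: "subgroup (F \<inter> K) G"
      using subF subK by (rule subgroups_Inter_pair)
    show ?thesis
    proof (cases "F \<inter> K = {\<one>\<^bsub>G\<^esub>}")
      case True
      then have "card (carrier V) \<le> card ?S"
        using m_le V_le_m by simp
      then have "?S = carrier V"
        using SV finV by (intro card_seteq) auto
      then have "v \<in> ?S"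
        using v by simp
      then obtain c k where ck: "c \<in> ?C F" "k \<in> ?C K" "v = c \<oplus>\<^bsub>V\<^esub> k"
        using v by (auto simp: set_mult_def)
      let ?z = "g \<otimes>\<^bsub>G\<^esub> y \<otimes>\<^bsub>G\<^esub> inv\<^bsub>G\<^esub> g"
      have G: "x \<in> carrier G" "?z \<in> carrier G"
        using x yK FG KG by auto
      have cV: "c \<in> carrier V" "act c x = c" and kV: "k \<in> carrier V" "act k ?z = k"
        using ck x yK by (auto simp: fixed_space_def)
      \<comment> \<open>\<open>x\<close> and \<open>?z\<close> commute in \<open>A\<close>, so
        \<open>?z\<close> fixes \<open>k x\<close> along with \<open>k\<close>. As \<open>x\<close>
        fixes \<open>c\<close>, only the component \<open>k\<close> contributes to
        \<open>v x - v\<close>.\<close>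
      have xk: "act (act k x) ?z = act k x"
        using comm_A[of x ?z] x yK FA KA kV G act_mult by (metis subsetD)
      have "act v x \<ominus>\<^bsub>V\<^esub> v = (act k x \<oplus>\<^bsub>V\<^esub> c) \<ominus>\<^bsub>V\<^esub> (k \<oplus>\<^bsub>V\<^esub> c)"
        using cV kV G unfolding ck(3) by (simp add: act_add M.a_comm)
      also have "\<dots> = act k x \<ominus>\<^bsub>V\<^esub> k"
        using cV kV G by (intro M.add_diff_cancel) auto
      finally have "act v x \<ominus>\<^bsub>V\<^esub> v = act k x \<ominus>\<^bsub>V\<^esub> k" .
      then show ?thesis
        using kV G xk by (simp add: act_minus)
    next
      case False
      \<comment> \<open>Both summands are fixed by \<open>F \<inter> K\<close>, so this intersection
        has weight at least \<open>m\<close>. Minimality gives \<open>F \<subseteq> K\<close>, and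
        equal size gives \<open>F = K\<close>.\<close>
      have "?S \<subseteq> ?C (F \<inter> K)"
        using FG by (auto simp: set_mult_def fixed_space_def act_add subset_eq)
      then have "card ?S \<le> card (?C (F \<inter> K))"
        using finV by (intro card_mono finite_fixed_space)
      then have "card (F \<inter> K) * card ?S \<le> weight (F \<inter> K)"
        by (simp add: weight_def)
      then have "F \<inter> K = F"
        using F_min[OF subFK _ False] m_le by simp
      then have "F \<subseteq> K"
        by blast
      moreover have "card K \<le> card F" "finite K"
        unfolding K_def using finF by (simp_all add: card_image_le)
      ultimately have "F = K"
        using card_seteq by blast
      then show ?thesis
        using quadF[OF v x] yK by simp
    qed
  qed
  \<comment> \<open>All conjugates of elements of \<open>F\<close>. They generate the normal closure
    of \<open>F\<close> and have the same fixed space; closure of \<open>T\<close> under conjugation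
    makes \<open>W\<close> invariant under \<open>G\<close>.\<close>
  define T where "T = {g \<otimes>\<^bsub>G\<^esub> f \<otimes>\<^bsub>G\<^esub> inv\<^bsub>G\<^esub> g | g f. g \<in> carrier G \<and> f \<in> F}"
  define W where "W = fixed_space V act T"
  define N where "N = {x \<in> carrier G. (\<forall>w\<in>W. act w x = w) \<and>
    (\<forall>v\<in>carrier V. act v x \<ominus>\<^bsub>V\<^esub> v \<in> W)}"
  have TG: "T \<subseteq> carrier G"
    using FG by (auto simp: T_def)
  have conjT: "h \<otimes>\<^bsub>G\<^esub> t \<otimes>\<^bsub>G\<^esub> inv\<^bsub>G\<^esub> h \<in> T" if t: "t \<in> T" and h: "h \<in> carrier G" for t h
  proof -
    obtain g f where gf: "t = g \<otimes>\<^bsub>G\<^esub> f \<otimes>\<^bsub>G\<^esub> inv\<^bsub>G\<^esub> g" "g \<in> carrier G" "f \<in> F"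
      using t by (auto simp: T_def)
    then show ?thesis
      using h FG conj_conj[of g h f] unfolding T_def by (blast intro: m_closed)
  qed
  have FT: "F \<subseteq> T"
  proof
    fix f assume f: "f \<in> F"
    then have "f = \<one>\<^bsub>G\<^esub> \<otimes>\<^bsub>G\<^esub> f \<otimes>\<^bsub>G\<^esub> inv\<^bsub>G\<^esub> \<one>\<^bsub>G\<^esub>"
      using FG by auto
    then show "f \<in> T"
      using f unfolding T_def by blast
  qed
  have "act w g \<in> W" if w: "w \<in> W" and g: "g \<in> carrier G" for w g
  proof -
    have wV: "w \<in> carrier V"
      using w by (simp add: W_def fixed_space_def)
    have "act (act w g) t = act w g" if t: "t \<in> T" for t
    proof -
      have tG: "t \<in> carrier G"
        using t TG by blast
      have "act w g = act (act w (g \<otimes>\<^bsub>G\<^esub> t \<otimes>\<^bsub>G\<^esub> inv\<^bsub>G\<^esub> g)) g"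
        using w conjT[OF t g] by (simp add: W_def fixed_space_def)
      also have "\<dots> = act (act w g) t"
        using wV g tG by (simp add: act_mult act_inv_cancel)
      finally show ?thesis by simp
    qed
    then show ?thesis
      using wV g by (simp add: W_def fixed_space_def)
  qed
  then have N: "N \<lhd> G"
    unfolding N_def W_def using TG by (intro normal_trivial_on_factors subgroup_fixed_space)
  have FN: "F \<subseteq> N"
  proof
    fix f assume f: "f \<in> F"
    have fG: "f \<in> carrier G"
      using f FG by blast
    have "act v f \<ominus>\<^bsub>V\<^esub> v \<in> W" if v: "v \<in> carrier V" for v
      using quad_conj[OF v f] v fG by (auto simp: W_def fixed_space_def T_def)
    moreover have "act w f = w" if "w \<in> W" for w
      using that f FT by (auto simp: W_def fixed_space_def)
    ultimately show "f \<in> N"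
      using fG by (simp add: N_def)
  qed
  have "N \<noteq> {\<one>\<^bsub>G\<^esub>}"
    using FN F1 subgroup.one_closed[OF subF] by blast
  then obtain z where z: "z \<in> N" "z \<in> Omega1 p G (group_center G)" "z \<noteq> \<one>\<^bsub>G\<^esub>"
    using normal_meets_Omega1_center[OF finG order p N] by blast
  \<comment> \<open>Every \<open>v z - v\<close> lies in \<open>W\<close>, where \<open>z\<close>
    acts trivially.\<close>
  then have "quadratic_on G V act z"
    by (auto simp: quadratic_on_iff N_def)
  with z show ?thesis
    by blast
qed

section \<open>Offenders in terms of weights\<close>

lemma offender_weight:
  assumes "offender p G V act E"
  shows "subgroup E G" "E \<noteq> {\<one>\<^bsub>G\<^esub>}" "finite (carrier V)" "card (carrier V) \<le> weight E"
proof -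
  show "subgroup E G" "E \<noteq> {\<one>\<^bsub>G\<^esub>}"
    using assms by (auto simp: offender_def elementary_abelian_subgroup_def commutative_subgroup_def)
  have j: "1 \<le> real (weight E) / real (card (carrier V))"
    using assms by (simp add: offender_def j_ratio_def weight_def)
  \<comment> \<open>An infinite \<open>V\<close> would have \<open>card\<close> 0, and division by 0
    yields 0, contradicting the ratio bound. Finiteness of \<open>V\<close> is thus read off from
    the offender.\<close>
  then have pos: "card (carrier V) > 0"
    by (cases "card (carrier V) = 0") auto
  then show "finite (carrier V)"
    using card_ge_0_finite by blast
  show "card (carrier V) \<le> weight E"
    using j pos by (simp add: field_simps)
qed

end

theorem theorem1p4:
  fixes p :: nat
    and G :: "('g, 'a) monoid_scheme"
    and V :: "(int, 'v, 'b) module_scheme"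
    and act :: "'v \<Rightarrow> 'g \<Rightarrow> 'v"
  assumes "Factorial_Ring.prime p" and "odd p"
    and "finite_p_group p G"
    and "FpG_module p G V act"
    and "faithful_module G V act"
    and "\<not> (\<exists>g \<in> Omega1 p G (group_center G). quadratic_on G V act g)"
  shows "(\<forall>A. A \<lhd> G \<and> commutative_subgroup G A \<longrightarrow>
            \<not> (\<exists>E. offender p G V act E \<and> E \<subseteq> A)) \<and>
         (\<forall>E. offender p G V act E \<longrightarrow>
            commutator_subgroup G (derived G (carrier G)) E \<noteq> {\<one>\<^bsub>G\<^esub>})"
proof -
  interpret FpG_module p G V act
    by fact
  obtain n where G: "finite (carrier G)" "order G = p ^ n"
    using assms(3) by (auto simp: finite_p_group_def)
  have part1: False
    if A: "A \<lhd> G" "commutative_subgroup G A" and E: "offender p G V act E" "E \<subseteq> A" for A E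
    using quadratic_of_abelian_normal[OF assms(1) G(2,1) offender_weight(3)[OF E(1)] A
        offender_weight(1)[OF E(1)] E(2) offender_weight(2,4)[OF E(1)]] assms(6) by blast
  have "commutator_subgroup G (derived G (carrier G)) E \<noteq> {\<one>\<^bsub>G\<^esub>}"
    if E: "offender p G V act E" for E
  proof
    assume triv: "commutator_subgroup G (derived G (carrier G)) E = {\<one>\<^bsub>G\<^esub>}"
    have "commutative_subgroup G E"
      using E by (simp add: offender_def elementary_abelian_subgroup_def)
    \<comment> \<open>An abelian normal subgroup containing \<open>E\<close> brings the second claim
      under the first.\<close>
    then obtain A where "A \<lhd> G" "commutative_subgroup G A" "E \<subseteq> A"
      using triv by (rule abelian_normal_closure)
    with part1 E show False
      by blast
  qed
  with part1 show ?thesis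
    by blast
qed

end
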